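(* Let $l \le m_l \le m_r \le r$ be real numbers, let $c\in[0,1]$, and let $t\ge 1$ be an integer. Let $A=(l,m_l,m_r,r)$ be the discrete leveled trapezoidal fuzzy number with equally spaced levels $\alpha_i=\frac{i}{t}$, $i=0,1,\dots,t$, and let the level weights be linearly increasing with respect to the levels according to the pattern $q_i=i$, i.e. $p_i=\frac{q_i}{\sum_{j=0}^t q_j}=\frac{2i}{t(t+1)}$ for $i=0,1,\dots,t$. Then $$WABL(A)=M(0)+\frac{2t+1}{3t}\bigl(M(1)-M(0)\bigr).$$
   Context: A trapezoidal fuzzy number $A=(l,m_l,m_r,r)$ with $l\le m_l\le m_r\le r$ real is described by its level sets $A_\alpha=[L(\alpha),R(\alpha)]$, where for $\alpha\in[0,1]$ $$L(\alpha)=l+\alpha(m_l-l),\qquad R(\alpha)=r-\alpha(r-m_r).$$ It is called a discrete leveled trapezoidal fuzzy number when only the level sets at finitely many levels $\alpha_0<\alpha_1<\dots<\alpha_t$ in $[0,1]$ are considered. Equally spaced levels ($\Delta\alpha=\text{const}$) means $\Delta\alpha=\frac1t$ and $\alpha_i=i\,\Delta\alpha=\frac{i}{t}$, $i=0,\dots,t$. For a fixed "optimism" coefficient $c\in[0,1]$, put $$M(\alpha)=(1-c)L(\alpha)+cR(\alpha),\qquad \alpha\in[0,1].$$ Given level weights $p_i\ge 0$, $i=0,\dots,t$, with $\sum_{i=0}^t p_i=1$, the Weighted Average Based on Levels (WABL) value of $A$ is $$WABL(A)=\sum_{i=0}^{t}p_i\,M(\alpha_i).$$ *)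

theory Defs
  imports Complex_Main
begin

(* The parameters (l, m_l, m_r, r).  The ordering l \<le> m_l \<le> m_r \<le> r is kept separate, in
   is_trapezoidal. *)
datatype trapezoid =
  Trapezoid (left_end: real) (mode_left: real) (mode_right: real) (right_end: real)

definition is_trapezoidal :: "trapezoid \<Rightarrow> bool" where
  "is_trapezoidal A \<longleftrightarrow>
     left_end A \<le> mode_left A \<and> mode_left A \<le> mode_right A \<and> mode_right A \<le> right_end A"

definition level_left :: "trapezoid \<Rightarrow> real \<Rightarrow> real" where
  "level_left A \<alpha> = left_end A + \<alpha> * (mode_left A - left_end A)"

definition level_right :: "trapezoid \<Rightarrow> real \<Rightarrow> real" where
  "level_right A \<alpha> = right_end A - \<alpha> * (right_end A - mode_right A)"

definition level_set :: "trapezoid \<Rightarrow> real \<Rightarrow> real set" where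
  "level_set A \<alpha> = {level_left A \<alpha> .. level_right A \<alpha>}"

definition level_mean :: "real \<Rightarrow> trapezoid \<Rightarrow> real \<Rightarrow> real" where
  "level_mean c A \<alpha> = (1 - c) * level_left A \<alpha> + c * level_right A \<alpha>"

(* Levels \<alpha>_0 < ... < \<alpha>_t and weights p_0, ..., p_t are functions on nat of which only the values
   at 0, ..., t matter. *)
definition is_levels :: "nat \<Rightarrow> (nat \<Rightarrow> real) \<Rightarrow> bool" where
  "is_levels t \<alpha> \<longleftrightarrow> (\<forall>i\<le>t. \<alpha> i \<in> {0..1}) \<and> strict_mono_on {..t} \<alpha>"

definition is_level_weights :: "nat \<Rightarrow> (nat \<Rightarrow> real) \<Rightarrow> bool" where
  "is_level_weights t p \<longleftrightarrow> (\<forall>i\<le>t. 0 \<le> p i) \<and> (\<Sum>i\<le>t. p i) = 1"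

definition WABL ::
  "real \<Rightarrow> nat \<Rightarrow> (nat \<Rightarrow> real) \<Rightarrow> (nat \<Rightarrow> real) \<Rightarrow> trapezoid \<Rightarrow> real" where
  "WABL c t \<alpha> p A = (\<Sum>i\<le>t. p i * level_mean c A (\<alpha> i))"

definition equally_spaced_levels :: "nat \<Rightarrow> nat \<Rightarrow> real" where
  "equally_spaced_levels t i = real i / real t"

definition pattern_weights :: "nat \<Rightarrow> (nat \<Rightarrow> real) \<Rightarrow> nat \<Rightarrow> real" where
  "pattern_weights t q i = q i / (\<Sum>j\<le>t. q j)"

lemma is_levels_equally_spaced:
  assumes "1 \<le> t"
  shows "is_levels t (equally_spaced_levels t)"
  using assms
  by (auto simp: is_levels_def equally_spaced_levels_def strict_mono_on_def divide_strict_right_mono)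

lemma pattern_weights_linear:
  "pattern_weights t (\<lambda>i. real i) i = 2 * real i / (real t * (real t + 1))"
proof -
  have "(\<Sum>j\<le>t. real j) = real t * (real t + 1) / 2"
    by (induction t) (simp_all add: field_simps)
  then show ?thesis
    unfolding pattern_weights_def by (simp only:) (simp add: mult.commute)
qed

lemma is_level_weights_linear:
  assumes "1 \<le> t"
  shows "is_level_weights t (pattern_weights t (\<lambda>i. real i))"
proof -
  have "0 < (\<Sum>j\<le>t. real j)"
    using assms by (intro sum_pos2[of _ t]) auto
  then show ?thesis
    by (auto simp: is_level_weights_def pattern_weights_def sum_nonneg
        simp flip: sum_divide_distrib)
qed

end

theory Submission
  imports Defs
begin

text \<open>Since \<open>M\<close> is affine in the level, \<open>WABL(A) = M(0) + (\<Sum>i. p\<^sub>i \<alpha>\<^sub>i) (M(1) - M(0))\<close>, and for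
  \<open>\<alpha>\<^sub>i = i/t\<close> with \<open>p\<^sub>i\<close> proportional to \<open>i\<close> the mean level is a sum of squares.\<close>

lemma level_mean_affine:
  "level_mean c A \<alpha> = level_mean c A 0 + \<alpha> * (level_mean c A 1 - level_mean c A 0)"
  by (simp add: level_mean_def level_left_def level_right_def algebra_simps)

text \<open>Weighting the affine form leaves the constant term \<open>level_mean c A 0\<close>
  unchanged because the weights sum to 1; nothing is asked of the levels.\<close>

lemma WABL_eq_mean_level:
  assumes "is_level_weights t p"
  shows "WABL c t \<alpha> p A
       = level_mean c A 0 + (\<Sum>i\<le>t. p i * \<alpha> i) * (level_mean c A 1 - level_mean c A 0)"
proof -
  define D where "D = level_mean c A 1 - level_mean c A 0"
  have "WABL c t \<alpha> p A = (\<Sum>i\<le>t. p i * level_mean c A 0 + p i * \<alpha> i * D)"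
    unfolding WABL_def D_def
    \<comment> \<open>The affine form is used only at the level \<open>\<alpha> i\<close>, since its
      right side contains further instances of its left side.\<close>
    by (intro sum.cong refl, subst level_mean_affine) (simp add: algebra_simps)
  also have "\<dots> = (\<Sum>i\<le>t. p i) * level_mean c A 0 + (\<Sum>i\<le>t. p i * \<alpha> i) * D"
    by (simp add: sum.distrib sum_distrib_right)
  finally show ?thesis
    using assms by (simp add: is_level_weights_def D_def)
qed

lemma sum_squares_real: "(\<Sum>i\<le>t. (real i)\<^sup>2) = real t * (real t + 1) * (2 * real t + 1) / 6"
  by (induction t) (simp_all add: field_simps power2_eq_square)

lemma mean_level_linear_weights:
  assumes "1 \<le> t"
  shows "(\<Sum>i\<le>t. pattern_weights t (\<lambda>i. real i) i * equally_spaced_levels t i)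
       = (2 * real t + 1) / (3 * real t)"
proof -
  \<comment> \<open>The constant collects \<open>2 / (real t * (real t + 1))\<close> from the weight
    and \<open>1 / real t\<close> from the level.\<close>
  have "(\<Sum>i\<le>t. pattern_weights t (\<lambda>i. real i) i * equally_spaced_levels t i)
      = (\<Sum>i\<le>t. 2 / (real t * (real t + 1) * real t) * (real i)\<^sup>2)"
    unfolding pattern_weights_linear equally_spaced_levels_def
    by (intro sum.cong refl) (simp add: power2_eq_square)
  also have "\<dots> = 2 / (real t * (real t + 1) * real t)
      * (real t * (real t + 1) * (2 * real t + 1) / 6)"
    by (simp only: sum_distrib_left[symmetric] sum_squares_real)
  also have "\<dots> = (2 * real t + 1) / (3 * real t)"
    \<comment> \<open>As \<open>1 \<le> t\<close>, the common factor
      \<open>real t * (real t + 1)\<close> is nonzero and cancels.\<close>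
    using assms by (simp add: divide_simps)
  finally show ?thesis .
qed

theorem theorem5p2:
  fixes l ml mr r c :: real and t :: nat and A :: trapezoid
  assumes "A = Trapezoid l ml mr r"
    and "is_trapezoidal A"
    and "c \<in> {0..1}"
    and "1 \<le> t"
  shows "WABL c t (equally_spaced_levels t) (pattern_weights t (\<lambda>i. real i)) A
       = level_mean c A 0
         + (2 * real t + 1) / (3 * real t) * (level_mean c A 1 - level_mean c A 0)"
  using WABL_eq_mean_level[OF is_level_weights_linear] mean_level_linear_weights \<open>1 \<le> t\<close>
  by simp

end
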